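(* Let $m,k$ be positive integers with $m\ge2$ and let $\{b_n\}_{n=1}^m\subset(0,\infty)$. Then there exists a discrete measure space $(X,\mathcal{A},\mu)$ together with the measurable transformation $\phi:X\to X$ of the one-circuit graph with $\kappa=1$ and $\eta_1=1$ described in the context, such that $\mu(x^1_{1,n})=b_n$ for $n=1,\dots,m$ and the associated composition operator $C_\phi\in B(L^2(\mu))$ is a $k$-quasi-$(m+2)$-isometry. Furthermore, when $m=1$ (i.e. for a single given $b_1\in(0,\infty)$), there exists, in the analogous manner (same $X$, $\mathcal{A}$, $\phi$, and $\mu(x^1_{1,1})=b_1$), such a measure $\mu$ for which the composition operator $C_\phi$ is a $k$-quasi-$2$-isometry.
   Context: For a bounded operator $T$ on a complex Hilbert space, $\mathcal{B}_m(T)=\sum_{j=0}^{m}(-1)^j\binom{m}{j}T^{*(m-j)}T^{m-j}$; $T$ is a $k$-quasi-$m$-isometry if $T^{*k}\mathcal{B}_m(T)T^k=0$. The one-circuit graph with $\kappa=1$ and $\eta_1=1$: $X=\{x_1\}\cup\{x^1_{1,j}:j=1,2,\dots\}$ (all points distinct), $\mathcal{A}$ is the $\sigma$-algebra of all subsets of $X$, and $\phi:X\to X$ is the parent map $\phi(x_1)=x_1$, $\phi(x^1_{1,1})=x_1$, $\phi(x^1_{1,j+1})=x^1_{1,j}$ for $j\ge1$. A discrete measure space here means that $\mu$ is a positive measure on $\mathcal{A}$ with $0<\mu(\{x\})<\infty$ for every $x\in X$; $\mu(x)$ means $\mu(\{x\})$. The composition operator is $C_\phi f=f\circ\phi$ on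 $L^2(\mu)=L^2(X,\mathcal{A},\mu)$. *)

theory Defs
  imports "HOL-Analysis.Analysis" "HOL-Library.Function_Algebras"
begin

section \<open>Bounded operators on a complex Hilbert space\<close>

text \<open>
  The Hilbert space is a linear subspace \<open>H\<close> of an ambient complex vector space, so that a space
  such as \<open>L\<^sup>2(\<mu>)\<close> can depend on a term \<open>\<mu>\<close>.  The inner product is linear in the first
  argument.  Operators are functions on the ambient type, of which only the values on \<open>H\<close> matter.
\<close>

locale complex_hilbert_space = vector_space scaleC
  for scaleC :: "complex \<Rightarrow> 'v::ab_group_add \<Rightarrow> 'v" +
  fixes H :: "'v set" and inner :: "'v \<Rightarrow> 'v \<Rightarrow> complex"
  assumes subspace_H: "subspace H"
    and inner_add: "\<lbrakk>f \<in> H; g \<in> H; h \<in> H\<rbrakk> \<Longrightarrow> inner (f + g) h = inner f h + inner g h"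
    and inner_scale: "\<lbrakk>f \<in> H; g \<in> H\<rbrakk> \<Longrightarrow> inner (scaleC c f) g = c * inner f g"
    and inner_cnj: "\<lbrakk>f \<in> H; g \<in> H\<rbrakk> \<Longrightarrow> inner g f = cnj (inner f g)"
    and inner_nonneg: "f \<in> H \<Longrightarrow> 0 \<le> Re (inner f f)"
    and inner_definite: "\<lbrakk>f \<in> H; inner f f = 0\<rbrakk> \<Longrightarrow> f = 0"
    and complete: "\<lbrakk>\<And>n. s n \<in> H;
        \<And>e. 0 < e \<Longrightarrow> \<exists>N::nat. \<forall>i\<ge>N. \<forall>j\<ge>N. sqrt (Re (inner (s i - s j) (s i - s j))) < e\<rbrakk>
      \<Longrightarrow> \<exists>l\<in>H. (\<lambda>n. sqrt (Re (inner (s n - l) (s n - l)))) \<longlonglongrightarrow> 0"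
begin

definition hnorm :: "'v \<Rightarrow> real" where
  "hnorm f = sqrt (Re (inner f f))"

definition bounded_operators :: "('v \<Rightarrow> 'v) set" where
  "bounded_operators = {T. (\<forall>f\<in>H. T f \<in> H) \<and>
     (\<forall>f\<in>H. \<forall>g\<in>H. T (f + g) = T f + T g) \<and>
     (\<forall>c. \<forall>f\<in>H. T (scaleC c f) = scaleC c (T f)) \<and>
     (\<exists>K. \<forall>f\<in>H. hnorm (T f) \<le> K * hnorm f)}"

definition adjoint :: "('v \<Rightarrow> 'v) \<Rightarrow> 'v \<Rightarrow> 'v" where
  "adjoint T g = (THE h. h \<in> H \<and> (\<forall>f\<in>H. inner (T f) g = inner f h))"

definition isometry_defect :: "nat \<Rightarrow> ('v \<Rightarrow> 'v) \<Rightarrow> 'v \<Rightarrow> 'v" where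
  "isometry_defect m T f =
     (\<Sum>j=0..m. scaleC ((- 1) ^ j * of_nat (m choose j))
        ((adjoint T ^^ (m - j)) ((T ^^ (m - j)) f)))"

definition quasi_isometry :: "nat \<Rightarrow> nat \<Rightarrow> ('v \<Rightarrow> 'v) \<Rightarrow> bool" where
  "quasi_isometry k m T \<longleftrightarrow> T \<in> bounded_operators \<and>
     (\<forall>f\<in>H. (adjoint T ^^ k) (isometry_defect m T ((T ^^ k) f)) = 0)"

lemma adjoint_eqI:
  assumes "h \<in> H" and "\<And>f. f \<in> H \<Longrightarrow> inner (T f) g = inner f h"
  shows "adjoint T g = h"
  unfolding adjoint_def
proof (rule the_equality)
  show "h \<in> H \<and> (\<forall>f\<in>H. inner (T f) g = inner f h)"
    using assms by blast
next
  fix h' assume h': "h' \<in> H \<and> (\<forall>f\<in>H. inner (T f) g = inner f h')"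
  have d: "h' - h \<in> H"
    using h' assms(1) subspace_H by (simp add: subspace_diff)
  have "inner (h' - h) h' = inner (h' - h) h"
    using h' assms(2) d by metis
  then have "inner h' (h' - h) = inner h (h' - h)"
    using h' assms(1) d inner_cnj by metis
  moreover have "inner h' (h' - h) = inner (h' - h) (h' - h) + inner h (h' - h)"
    using inner_add[OF d assms(1) d] by simp
  ultimately show "h' = h"
    using inner_definite[OF d] by simp
qed

end

section \<open>\<open>L\<^sup>2\<close> of a discrete measure space\<close>

locale discrete_measure_space =
  fixes M :: "'a measure"
  assumes space_eq: "space M = UNIV"
    and sets_eq: "sets M = UNIV"
    and point_mass: "\<And>x. 0 < emeasure M {x} \<and> emeasure M {x} < \<infinity>"

text \<open>
  The elements are functions rather than classes modulo equality almost everywhere; when every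
  point has positive mass the two coincide.
\<close>

definition L2 :: "'a measure \<Rightarrow> ('a \<Rightarrow> complex) set" where
  "L2 M = {f. f \<in> borel_measurable M \<and> integrable M (\<lambda>x. (cmod (f x))\<^sup>2)}"

definition L2_inner :: "'a measure \<Rightarrow> ('a \<Rightarrow> complex) \<Rightarrow> ('a \<Rightarrow> complex) \<Rightarrow> complex" where
  "L2_inner M f g = (\<integral>x. f x * cnj (g x) \<partial>M)"

definition fun_scale :: "complex \<Rightarrow> ('a \<Rightarrow> complex) \<Rightarrow> 'a \<Rightarrow> complex" where
  "fun_scale c f = (\<lambda>x. c * f x)"

abbreviation L2_bounded_operators :: "'a measure \<Rightarrow> (('a \<Rightarrow> complex) \<Rightarrow> 'a \<Rightarrow> complex) set" where
  "L2_bounded_operators M \<equiv>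
     complex_hilbert_space.bounded_operators fun_scale (L2 M) (L2_inner M)"

abbreviation L2_quasi_isometry ::
  "'a measure \<Rightarrow> nat \<Rightarrow> nat \<Rightarrow> (('a \<Rightarrow> complex) \<Rightarrow> 'a \<Rightarrow> complex) \<Rightarrow> bool" where
  "L2_quasi_isometry M \<equiv>
     complex_hilbert_space.quasi_isometry fun_scale (L2 M) (L2_inner M)"

context discrete_measure_space
begin

lemma measurable_all: "f \<in> M \<rightarrow>\<^sub>M N \<longleftrightarrow> f \<in> UNIV \<rightarrow> space N"
  by (auto simp: measurable_def space_eq sets_eq)

lemma L2_iff: "f \<in> L2 M \<longleftrightarrow> integrable M (\<lambda>x. (cmod (f x))\<^sup>2)"
  by (auto simp: L2_def measurable_all)

lemma L2_iff_nn: "f \<in> L2 M \<longleftrightarrow> (\<integral>\<^sup>+x. ennreal ((cmod (f x))\<^sup>2) \<partial>M) < \<infinity>"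
  by (auto simp: L2_iff integrable_iff_bounded measurable_all)

lemma L2_add:
  assumes "f \<in> L2 M" "g \<in> L2 M"
  shows "f + g \<in> L2 M"
proof -
  have "integrable M (\<lambda>x. 2 * (cmod (f x))\<^sup>2 + 2 * (cmod (g x))\<^sup>2)"
    using assms by (auto simp: L2_iff)
  moreover have "(cmod (f x + g x))\<^sup>2 \<le> 2 * (cmod (f x))\<^sup>2 + 2 * (cmod (g x))\<^sup>2" for x
  proof -
    have "(cmod (f x + g x))\<^sup>2 \<le> (cmod (f x) + cmod (g x))\<^sup>2"
      by (intro power_mono norm_triangle_ineq) auto
    also have "\<dots> \<le> 2 * (cmod (f x))\<^sup>2 + 2 * (cmod (g x))\<^sup>2"
      using zero_le_power2[of "cmod (f x) - cmod (g x)"]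
      by (simp add: power2_eq_square algebra_simps)
    finally show ?thesis .
  qed
  ultimately show ?thesis
    unfolding L2_iff
    by (elim Bochner_Integration.integrable_bound) (auto simp: measurable_all)
qed

lemma L2_scale: "f \<in> L2 M \<Longrightarrow> fun_scale c f \<in> L2 M"
  by (auto simp: L2_iff fun_scale_def norm_mult power_mult_distrib)

lemma L2_diff:
  assumes "f \<in> L2 M" "g \<in> L2 M"
  shows "f - g \<in> L2 M"
proof -
  have "f - g = f + fun_scale (- 1) g"
    by (auto simp: fun_scale_def)
  then show ?thesis
    using L2_add[OF assms(1) L2_scale[OF assms(2)]] by metis
qed

lemma integrable_L2_inner:
  assumes "f \<in> L2 M" "g \<in> L2 M"
  shows "integrable M (\<lambda>x. f x * cnj (g x))"
proof -
  have "integrable M (\<lambda>x. (cmod (f x))\<^sup>2 + (cmod (g x))\<^sup>2)"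
    using assms by (auto simp: L2_iff)
  moreover have "cmod (f x) * cmod (g x) \<le> (cmod (f x))\<^sup>2 + (cmod (g x))\<^sup>2" for x
  proof -
    have "2 * (cmod (f x) * cmod (g x)) \<le> (cmod (f x))\<^sup>2 + (cmod (g x))\<^sup>2"
      using zero_le_power2[of "cmod (f x) - cmod (g x)"]
      by (simp add: power2_eq_square algebra_simps)
    moreover have "0 \<le> cmod (f x) * cmod (g x)"
      by simp
    ultimately show ?thesis
      by linarith
  qed
  ultimately show ?thesis
    by (elim Bochner_Integration.integrable_bound) (auto simp: measurable_all norm_mult)
qed

lemma L2_inner_self: "L2_inner M f f = of_real (\<integral>x. (cmod (f x))\<^sup>2 \<partial>M)"
  unfolding L2_inner_def complex_norm_square[symmetric] by (rule integral_complex_of_real)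

lemma nn_integral_L2:
  assumes "f \<in> L2 M"
  shows "(\<integral>\<^sup>+x. ennreal ((cmod (f x))\<^sup>2) \<partial>M) = ennreal (Re (L2_inner M f f))"
  using assms by (simp add: L2_inner_self L2_iff nn_integral_eq_integral)

lemma point_le_L2:
  assumes "f \<in> L2 M"
  shows "(cmod (f x))\<^sup>2 * measure M {x} \<le> Re (L2_inner M f f)"
proof -
  have fin: "emeasure M {x} < \<infinity>" using point_mass by blast
  have "(cmod (f x))\<^sup>2 * measure M {x} = (\<integral>y. (cmod (f x))\<^sup>2 * indicator {x} y \<partial>M)"
    by (simp add: space_eq)
  also have "\<dots> \<le> (\<integral>y. (cmod (f y))\<^sup>2 \<partial>M)"
  proof (rule integral_mono)
    show "integrable M (\<lambda>y. (cmod (f x))\<^sup>2 * indicator {x} y)"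
      using fin by (intro integrable_mult_right integrable_real_indicator) (auto simp: sets_eq)
    show "integrable M (\<lambda>y. (cmod (f y))\<^sup>2)"
      using assms by (simp add: L2_iff)
  qed (auto simp: indicator_def)
  finally show ?thesis by (simp add: L2_inner_self)
qed

lemma measure_point_pos: "0 < measure M {x}"
  using point_mass[of x] by (auto simp: measure_def enn2real_positive_iff less_top)

lemma L2_complete:
  fixes s :: "nat \<Rightarrow> 'a \<Rightarrow> complex"
  assumes s: "\<And>n. s n \<in> L2 M"
    and cauchy: "\<And>e. 0 < e \<Longrightarrow> \<exists>N. \<forall>i\<ge>N. \<forall>j\<ge>N. sqrt (Re (L2_inner M (s i - s j) (s i - s j))) < e"
  shows "\<exists>l\<in>L2 M. (\<lambda>n. sqrt (Re (L2_inner M (s n - l) (s n - l)))) \<longlonglongrightarrow> 0"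
proof -
  have "Cauchy (\<lambda>n. s n x)" for x
  proof (rule metric_CauchyI)
    fix e :: real assume e: "0 < e"
    let ?w = "sqrt (measure M {x})"
    have w: "0 < ?w" using measure_point_pos by simp
    obtain N where N: "\<And>i j. i \<ge> N \<Longrightarrow> j \<ge> N \<Longrightarrow>
        sqrt (Re (L2_inner M (s i - s j) (s i - s j))) < e * ?w"
      using cauchy[of "e * ?w"] e w by auto
    have "dist (s i x) (s j x) < e" if "i \<ge> N" "j \<ge> N" for i j
    proof -
      have "cmod (s i x - s j x) * ?w = sqrt ((cmod ((s i - s j) x))\<^sup>2 * measure M {x})"
        by (simp add: real_sqrt_mult)
      also have "\<dots> \<le> sqrt (Re (L2_inner M (s i - s j) (s i - s j)))"
        by (intro real_sqrt_le_mono point_le_L2 L2_diff s)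
      also have "\<dots> < e * ?w" by (rule N[OF that])
      finally show ?thesis using w by (simp add: dist_norm)
    qed
    then show "\<exists>N. \<forall>i\<ge>N. \<forall>j\<ge>N. dist (s i x) (s j x) < e" by blast
  qed
  then have "\<exists>y. (\<lambda>n. s n x) \<longlonglongrightarrow> y" for x
    using Cauchy_convergent_iff convergent_def by metis
  then obtain l where l: "\<And>x. (\<lambda>n. s n x) \<longlonglongrightarrow> l x"
    by metis
  have bound: "(\<integral>\<^sup>+x. ennreal ((cmod (s n x - l x))\<^sup>2) \<partial>M) \<le> ennreal (e\<^sup>2)"
    if e: "0 < e" and N: "\<And>j. j \<ge> N \<Longrightarrow> sqrt (Re (L2_inner M (s n - s j) (s n - s j))) < e"
    for n N :: nat and e :: real
  proof -
    have "(\<integral>\<^sup>+x. ennreal ((cmod (s n x - l x))\<^sup>2) \<partial>M)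
        = (\<integral>\<^sup>+x. liminf (\<lambda>j. ennreal ((cmod (s n x - s j x))\<^sup>2)) \<partial>M)"
    proof (rule nn_integral_cong)
      fix x
      have "(\<lambda>j. ennreal ((cmod (s n x - s j x))\<^sup>2)) \<longlonglongrightarrow> ennreal ((cmod (s n x - l x))\<^sup>2)"
        by (intro tendsto_intros l)
      then show "ennreal ((cmod (s n x - l x))\<^sup>2) = liminf (\<lambda>j. ennreal ((cmod (s n x - s j x))\<^sup>2))"
        by (intro lim_imp_Liminf[symmetric] trivial_limit_sequentially)
    qed
    also have "\<dots> \<le> liminf (\<lambda>j. \<integral>\<^sup>+x. ennreal ((cmod (s n x - s j x))\<^sup>2) \<partial>M)"
      by (rule nn_integral_liminf) (simp add: measurable_all)
    also have "\<dots> \<le> liminf (\<lambda>j::nat. ennreal (e\<^sup>2))"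
    proof (rule Liminf_mono)
      show "\<forall>\<^sub>F j in sequentially. (\<integral>\<^sup>+x. ennreal ((cmod (s n x - s j x))\<^sup>2) \<partial>M) \<le> ennreal (e\<^sup>2)"
        using eventually_ge_at_top[of N]
      proof eventually_elim
        fix j assume "N \<le> j"
        then have "Re (L2_inner M (s n - s j) (s n - s j)) \<le> e\<^sup>2"
          using N[of j] sqrt_le_D less_imp_le by blast
        then show "(\<integral>\<^sup>+x. ennreal ((cmod (s n x - s j x))\<^sup>2) \<partial>M) \<le> ennreal (e\<^sup>2)"
          using nn_integral_L2[OF L2_diff[OF s s], of n j] by (simp add: ennreal_leI)
      qed
    qed
    finally show ?thesis by (simp add: Liminf_const)
  qed
  have diff_in: "s n - l \<in> L2 M \<and> sqrt (Re (L2_inner M (s n - l) (s n - l))) \<le> e"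
    if e: "0 < e" and N: "\<And>j. j \<ge> N \<Longrightarrow> sqrt (Re (L2_inner M (s n - s j) (s n - s j))) < e"
    for n N :: nat and e :: real
  proof -
    have b: "(\<integral>\<^sup>+x. ennreal ((cmod ((s n - l) x))\<^sup>2) \<partial>M) \<le> ennreal (e\<^sup>2)"
      using bound[OF e N] by simp
    then have mem: "s n - l \<in> L2 M"
      unfolding L2_iff_nn using le_less_trans[OF b, of \<infinity>] by simp
    have "Re (L2_inner M (s n - l) (s n - l)) \<le> e\<^sup>2"
      using b unfolding nn_integral_L2[OF mem] by (simp add: ennreal_le_iff)
    then show ?thesis
      using mem e by (auto intro: real_le_lsqrt simp: L2_inner_self)
  qed
  obtain N where "\<And>i j. i \<ge> N \<Longrightarrow> j \<ge> N \<Longrightarrow>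
      sqrt (Re (L2_inner M (s i - s j) (s i - s j))) < 1"
    using cauchy[of 1] by auto
  then have "s N - l \<in> L2 M" using diff_in[of 1 N N] by auto
  then have "s N - (s N - l) \<in> L2 M" using s L2_diff by blast
  then have "l \<in> L2 M" by simp
  moreover have "(\<lambda>n. sqrt (Re (L2_inner M (s n - l) (s n - l)))) \<longlonglongrightarrow> 0"
  proof (rule LIMSEQ_I)
    fix r :: real assume r: "0 < r"
    obtain N where N: "\<And>i j. i \<ge> N \<Longrightarrow> j \<ge> N \<Longrightarrow>
        sqrt (Re (L2_inner M (s i - s j) (s i - s j))) < r / 2"
      using cauchy[of "r / 2"] r by auto
    have "norm (sqrt (Re (L2_inner M (s n - l) (s n - l))) - 0) < r" if "n \<ge> N" for n
    proof -
      have "sqrt (Re (L2_inner M (s n - l) (s n - l))) \<le> r / 2"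
        using diff_in[of "r / 2" N n] N that r by auto
      then show ?thesis using r by (simp add: L2_inner_self)
    qed
    then show "\<exists>N. \<forall>n\<ge>N. norm (sqrt (Re (L2_inner M (s n - l) (s n - l))) - 0) < r"
      by blast
  qed
  ultimately show ?thesis by blast
qed

sublocale L2: complex_hilbert_space fun_scale "L2 M" "L2_inner M"
proof -
  interpret vector_space "fun_scale :: complex \<Rightarrow> ('a \<Rightarrow> complex) \<Rightarrow> 'a \<Rightarrow> complex"
    by unfold_locales (auto simp: fun_scale_def fun_eq_iff algebra_simps)
  show "complex_hilbert_space fun_scale (L2 M) (L2_inner M)"
  proof unfold_locales
    show "subspace (L2 M)"
      by (rule subspaceI) (auto simp: L2_add L2_scale, simp add: L2_iff)
  next
    fix f g h assume "f \<in> L2 M" "g \<in> L2 M" "h \<in> L2 M"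
    then show "L2_inner M (f + g) h = L2_inner M f h + L2_inner M g h"
      by (simp add: L2_inner_def ring_distribs integrable_L2_inner)
  next
    fix f g c
    show "L2_inner M (fun_scale c f) g = c * L2_inner M f g"
      by (simp add: L2_inner_def fun_scale_def mult.assoc)
  next
    fix f g
    have "L2_inner M g f = (\<integral>x. cnj (f x * cnj (g x)) \<partial>M)"
      by (simp add: L2_inner_def mult.commute)
    then show "L2_inner M g f = cnj (L2_inner M f g)"
      unfolding L2_inner_def by (simp only: Bochner_Integration.integral_cnj)
  next
    fix f show "0 \<le> Re (L2_inner M f f)" by (simp add: L2_inner_self)
  next
    fix f assume f: "f \<in> L2 M" and 0: "L2_inner M f f = 0"
    show "f = 0"
    proof
      fix x
      have "(cmod (f x))\<^sup>2 * measure M {x} \<le> 0"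
        using point_le_L2[OF f, of x] 0 by simp
      then show "f x = 0 x"
        using measure_point_pos[of x] by (simp add: mult_le_0_iff)
    qed
  next
    fix s :: "nat \<Rightarrow> 'a \<Rightarrow> complex"
    assume "\<And>n. s n \<in> L2 M" and "\<And>e. 0 < e \<Longrightarrow>
      \<exists>N. \<forall>i\<ge>N. \<forall>j\<ge>N. sqrt (Re (L2_inner M (s i - s j) (s i - s j))) < e"
    then show "\<exists>l\<in>L2 M. (\<lambda>n. sqrt (Re (L2_inner M (s n - l) (s n - l)))) \<longlonglongrightarrow> 0"
      by (rule L2_complete)
  qed
qed

end

definition composition_operator :: "('a \<Rightarrow> 'a) \<Rightarrow> ('a \<Rightarrow> complex) \<Rightarrow> 'a \<Rightarrow> complex" where
  "composition_operator \<phi> f = f \<circ> \<phi>"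

section \<open>The one-circuit graph with one circuit vertex and one branch\<close>

text \<open>\<open>Circuit\<close> is \<open>x\<^sub>1\<close>, and \<open>Branch i\<close> is the vertex with branch index \<open>j = i + 1\<close>.\<close>

datatype vertex = Circuit | Branch nat

fun parent :: "vertex \<Rightarrow> vertex" where
  "parent Circuit = Circuit"
| "parent (Branch 0) = Circuit"
| "parent (Branch (Suc i)) = Branch i"

definition branch_vertex :: "nat \<Rightarrow> vertex" where
  "branch_vertex j = Branch (j - 1)"

lemma vertex_set: "UNIV = {Circuit} \<union> branch_vertex ` {1..}"
proof -
  have "v \<in> {Circuit} \<union> branch_vertex ` {1..}" for v
    by (cases v) (auto simp: branch_vertex_def intro!: image_eqI[where x = "Suc n" for n])
  then show ?thesis by blast
qed

lemma inj_on_branch_vertex: "inj_on branch_vertex {1..}"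
  by (auto simp: inj_on_def branch_vertex_def)

lemma parent_branch_vertex:
  "parent (branch_vertex 1) = Circuit"
  "1 \<le> j \<Longrightarrow> parent (branch_vertex (j + 1)) = branch_vertex j"
  by (cases j; simp add: branch_vertex_def)+

end

theory Submission
  imports Defs "HOL-Computational_Algebra.Polynomial"
begin

text \<open>
  Write \<open>T\<close> for the composition operator, and let the circuit vertex have mass \<open>1\<close> and
  \<open>Branch i\<close> mass \<open>c i\<close>.  Then \<open>T* ^ p T ^ p\<close> is multiplication by the mass of the
  \<open>p\<close>-th preimage of a vertex divided by the mass of the vertex, that is, by
  \<open>c (i + p) / c i\<close> at \<open>Branch i\<close> and by \<open>1 + (\<Sum>i<p. c i)\<close> at the circuit vertex.  So the
  defect of order \<open>n\<close> of \<open>T\<close> is multiplication by \<open>n\<close>-th differences of these quantities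
  (\<open>isometry_defect_apply\<close>).  If \<open>c\<close> is polynomial of degree at most \<open>D\<close>, then its
  partial sums are polynomial of degree at most \<open>D + 1\<close>, all differences of order \<open>D + 2\<close>
  vanish, and \<open>T\<close> is a \<open>(D + 2)\<close>-isometry; a fortiori it is a \<open>k\<close>-quasi-\<open>(D + 2)\<close>-isometry
  for every \<open>k\<close> (\<open>newton_weights_quasi_isometry\<close>).

  It remains to find a positive polynomial sequence of degree at most \<open>m\<close> with \<open>m\<close> prescribed
  positive values, and with bounded quotients of successive terms so that \<open>T\<close> is bounded
  (\<open>positive_newton_interpolation\<close>).  For one prescribed value a constant sequence, of
  degree \<open>0\<close>, suffices.
\<close>

section \<open>Finite differences of Newton expansions\<close>

text \<open>
  The left-hand side is the coefficient of \<open>x^r\<close> in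
  \<open>(1 + x)^i * ((1 + x) - 1)^M = (1 + x)^i * x^M\<close>.
\<close>

lemma alternating_binomial_sum_eq_0:
  fixes M i r :: nat
  assumes "r < M"
  shows "(\<Sum>j=0..M. (- 1) ^ j * of_nat (M choose j) * of_nat ((i + (M - j)) choose r))
    = (0 :: 'a :: comm_ring_1)"
proof -
  have coeff_power: "coeff ([:1, 1:] ^ n) r = (of_nat (n choose r) :: 'a)" for n
  proof (cases "r \<le> n")
    case True
    then show ?thesis by (simp add: coeff_linear_poly_power)
  next
    case False
    have "degree ([:1, 1 :: 'a:] ^ n) \<le> n"
      using degree_power_le[of "[:1, 1 :: 'a:]" n] degree_pCons_le[of 1 "[:1 :: 'a:]"]
      by (simp add: order_trans[OF degree_power_le])
    with False show ?thesis by (simp add: coeff_eq_0 binomial_eq_0)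
  qed
  have "(\<Sum>j=0..M. (- 1) ^ j * of_nat (M choose j) * [:1, 1 :: 'a:] ^ (i + (M - j)))
      = [:1, 1:] ^ i * (\<Sum>j\<le>M. of_nat (M choose j) * (- 1) ^ j * [:1, 1 :: 'a:] ^ (M - j))"
    unfolding sum_distrib_left atLeast0AtMost
    by (intro sum.cong refl) (simp only: power_add mult_ac)
  also have "\<dots> = [:1, 1:] ^ i * (- 1 + [:1, 1 :: 'a:]) ^ M"
    by (simp only: binomial_ring)
  also have "- 1 + [:1, 1 :: 'a:] = monom 1 1"
    by (simp add: monom_altdef one_pCons)
  finally have "coeff (\<Sum>j=0..M. (- 1) ^ j * of_nat (M choose j) * [:1, 1 :: 'a:] ^ (i + (M - j))) r
      = coeff (monom 1 M * [:1, 1:] ^ i) r"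
    by (simp add: monom_power mult.commute)
  also have "\<dots> = 0"
    using assms by (simp add: coeff_monom_mult)
  moreover have "coeff ((- 1) ^ j * of_nat (M choose j) * p) r
      = (- 1) ^ j * of_nat (M choose j) * coeff p r" for j and p :: "'a poly"
  proof -
    have "(- 1) ^ j * of_nat (M choose j) * p = smult ((- 1) ^ j * of_nat (M choose j)) p"
      by (cases "even j") (simp_all add: of_nat_poly)
    then show ?thesis by simp
  qed
  ultimately show ?thesis
    by (simp add: coeff_sum coeff_power)
qed

text \<open>
  A polynomial sequence of degree at most \<open>D\<close> in the binomial basis;
  for \<open>r \<le> D\<close>, \<open>d r\<close> is its \<open>r\<close>-th forward difference at \<open>0\<close>.
\<close>

definition newton_sum :: "(nat \<Rightarrow> real) \<Rightarrow> nat \<Rightarrow> nat \<Rightarrow> real" where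
  "newton_sum d D n = (\<Sum>r\<le>D. d r * real (n choose r))"

lemma alternating_newton_sum_eq_0:
  assumes "D < M"
  shows "(\<Sum>j=0..M. (- 1) ^ j * real (M choose j) * newton_sum d D (i + (M - j))) = 0"
proof -
  have "(\<Sum>j=0..M. (- 1) ^ j * real (M choose j) * newton_sum d D (i + (M - j)))
      = (\<Sum>r\<le>D. d r * (\<Sum>j=0..M. (- 1) ^ j * of_nat (M choose j)
          * of_nat ((i + (M - j)) choose r)))"
    unfolding newton_sum_def sum_distrib_left
    by (subst sum.swap) (intro sum.cong; simp add: mult_ac)
  also have "\<dots> = 0"
    using assms by (intro sum.neutral) (auto simp only: alternating_binomial_sum_eq_0 atMost_iff mult_zero_right)
  finally show ?thesis .
qed

lemma newton_sum_Suc_diff: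
  "newton_sum d (Suc D) (Suc n) = newton_sum d (Suc D) n + newton_sum (\<lambda>r. d (Suc r)) D n"
  by (simp only: newton_sum_def sum.atMost_Suc_shift) (simp add: algebra_simps sum.distrib)

lemma one_plus_sum_newton_sum:
  "1 + (\<Sum>i<p. newton_sum d D i) = newton_sum (case_nat 1 d) (Suc D) p"
proof (induction p)
  case 0
  show ?case by (simp only: newton_sum_def sum.atMost_Suc_shift) simp
next
  case (Suc p)
  then show ?case by (simp add: newton_sum_Suc_diff)
qed

text \<open>The system for \<open>d\<close> is triangular with unit diagonal, since \<open>i choose r = 0\<close> for \<open>r > i\<close>.\<close>

lemma newton_interpolation:
  "\<exists>d. \<forall>i<m. (\<Sum>r<m. d r * real (i choose r)) = b i"
proof (induction m)
  case (Suc m)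
  then obtain d where d: "\<And>i. i < m \<Longrightarrow> (\<Sum>r<m. d r * real (i choose r)) = b i" by blast
  let ?d = "d(m := b m - (\<Sum>r<m. d r * real (m choose r)))"
  have "(\<Sum>r<Suc m. ?d r * real (i choose r)) = b i" if "i < Suc m" for i
    using that d[of i] by (cases "i = m") simp_all
  then show ?case by blast
qed simp

lemma binomial_le_mult_binomial:
  assumes "j \<le> m" "m \<le> n"
  shows "(n choose j) \<le> (m choose j) * (n choose m)"
proof -
  have "0 < (n - j) choose (m - j)"
    using assms by (simp add: zero_less_binomial_iff)
  then show ?thesis
    using choose_mult[OF assms] by (metis mult.commute mult_le_mono2 mult_1_right One_nat_def Suc_leI)
qed

text \<open>
  A positive sequence through the prescribed values that is polynomial of degree at most \<open>m\<close> and
  has bounded growth rate: the interpolating polynomial of degree below \<open>m\<close> may become negative,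
  but adding a large multiple of \<open>n choose m\<close> repairs that without disturbing the prescribed
  values, because this term dominates all lower ones for \<open>n \<ge> m\<close> and vanishes for \<open>n < m\<close>.
\<close>

lemma positive_newton_interpolation:
  fixes b :: "nat \<Rightarrow> real"
  assumes m: "0 < m" and b: "\<And>i. i < m \<Longrightarrow> 0 < b i"
  obtains d K where "\<And>i. i < m \<Longrightarrow> newton_sum d m i = b i"
    and "\<And>n. 0 < newton_sum d m n"
    and "\<And>n. newton_sum d m (Suc n) \<le> K * newton_sum d m n"
proof -
  obtain d0 where d0: "\<And>i. i < m \<Longrightarrow> (\<Sum>r<m. d0 r * real (i choose r)) = b i"
    using newton_interpolation[of m b] by blast
  define t where "t = 1 + (\<Sum>r<m. \<bar>d0 r\<bar> * real (m choose r))"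
  define d where "d = d0(m := t)"
  have split: "newton_sum d m n = (\<Sum>r<m. d0 r * real (n choose r)) + t * real (n choose m)" for n
    by (simp add: newton_sum_def d_def flip: lessThan_Suc_atMost)
  have interp: "newton_sum d m i = b i" if "i < m" for i
    using that d0 by (simp add: split)
  have term_bound: "\<bar>x * real (n choose r)\<bar> \<le> \<bar>x\<bar> * real (m choose r) * real (n choose m)"
    if "m \<le> n" "r \<le> m" for n r x
    using binomial_le_mult_binomial[OF that(2,1)]
    by (simp add: abs_mult mult.assoc mult_left_mono flip: of_nat_mult)
  have large: "real (n choose m) \<le> newton_sum d m n" if "m \<le> n" for n
  proof -
    have "\<bar>\<Sum>r<m. d0 r * real (n choose r)\<bar> \<le> (\<Sum>r<m. \<bar>d0 r\<bar> * real (m choose r) * real (n choose m))"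
      using term_bound[OF that] by (intro order_trans[OF sum_abs] sum_mono) simp
    also have "\<dots> = (t - 1) * real (n choose m)"
      by (simp add: t_def sum_distrib_right)
    finally show ?thesis by (simp add: split algebra_simps)
  qed
  have pos: "0 < newton_sum d m n" for n
  proof (cases "n < m")
    case True
    then show ?thesis using b by (simp add: interp)
  next
    case False
    then have "0 < real (n choose m)" by (simp add: zero_less_binomial_iff)
    also have "\<dots> \<le> newton_sum d m n"
      using False by (simp add: large)
    finally show ?thesis .
  qed
  obtain m' where m': "m = Suc m'" using m by (cases m) auto
  \<comment> \<open>For \<open>n \<ge> m\<close> the increment of the sequence has lower degree, so a multiple of
    \<open>n choose m\<close>, hence of the sequence itself, dominates it.\<close>
  define K1 where "K1 = 1 + (\<Sum>r\<le>m'. \<bar>d (Suc r)\<bar> * real (m choose r))"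
  have K1: "newton_sum d m (Suc n) \<le> K1 * newton_sum d m n" if "m \<le> n" for n
  proof -
    have "newton_sum (\<lambda>r. d (Suc r)) m' n \<le> (\<Sum>r\<le>m'. \<bar>d (Suc r)\<bar> * real (m choose r) * real (n choose m))"
      unfolding newton_sum_def
      using term_bound[OF that] m'
      by (intro sum_mono) (rule order_trans[OF abs_ge_self], simp)
    also have "\<dots> = (K1 - 1) * real (n choose m)"
      by (simp add: K1_def sum_distrib_right)
    also have "\<dots> \<le> (K1 - 1) * newton_sum d m n"
      using large[OF that] by (intro mult_left_mono) (simp_all add: K1_def sum_nonneg)
    finally show ?thesis
      unfolding m' newton_sum_Suc_diff by (simp add: algebra_simps)
  qed
  define K2 where "K2 = (\<Sum>n<m. newton_sum d m (Suc n) / newton_sum d m n)"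
  have K2: "newton_sum d m (Suc n) \<le> K2 * newton_sum d m n" if "n < m" for n
  proof -
    have "newton_sum d m (Suc n) / newton_sum d m n \<le> K2"
      unfolding K2_def using that pos
      by (intro member_le_sum[of n "{..<m}" "\<lambda>n. newton_sum d m (Suc n) / newton_sum d m n"])
         (auto intro: divide_nonneg_nonneg less_imp_le)
    then show ?thesis using pos[of n] by (simp add: pos_divide_le_eq)
  qed
  have "newton_sum d m (Suc n) \<le> max K1 K2 * newton_sum d m n" for n
  proof -
    have "newton_sum d m (Suc n) \<le> K1 * newton_sum d m n \<or> newton_sum d m (Suc n) \<le> K2 * newton_sum d m n"
      using K1[of n] K2[of n] by linarith
    moreover have "K1 * newton_sum d m n \<le> max K1 K2 * newton_sum d m n"
      "K2 * newton_sum d m n \<le> max K1 K2 * newton_sum d m n"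
      using pos[of n] by (simp_all add: mult_right_mono)
    ultimately show ?thesis by linarith
  qed
  with that interp pos show thesis by blast
qed

section \<open>The composition operator of a weighted one-circuit graph\<close>

text \<open>The measure with mass \<open>1\<close> at the circuit vertex and mass \<open>c i\<close> at \<open>Branch i\<close>.\<close>

definition vertex_weight :: "(nat \<Rightarrow> real) \<Rightarrow> vertex \<Rightarrow> real" where
  "vertex_weight c = case_vertex 1 c"

definition circuit_measure :: "(nat \<Rightarrow> real) \<Rightarrow> vertex measure" where
  "circuit_measure c = density (count_space UNIV) (\<lambda>v. ennreal (vertex_weight c v))"

text \<open>An enumeration of the vertices, which turns integrals into series.\<close>

definition vertex_of_nat :: "nat \<Rightarrow> vertex" where
  "vertex_of_nat = case_nat Circuit Branch"

lemma bij_vertex_of_nat: "bij vertex_of_nat"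
proof (rule bijI)
  show "inj vertex_of_nat"
    by (auto simp: inj_def vertex_of_nat_def split: nat.splits)
  have "v \<in> range vertex_of_nat" for v
    by (cases v) (auto simp: vertex_of_nat_def image_iff intro: exI[of _ 0] exI[of _ "Suc _"])
  then show "surj vertex_of_nat" by blast
qed

text \<open>The bound on the growth of the weights makes the composition operator bounded.\<close>

locale weighted_circuit =
  fixes c :: "nat \<Rightarrow> real" and K :: real
  assumes weight_pos: "0 < c i" and weight_growth: "c (Suc i) \<le> K * c i"
begin

abbreviation "M \<equiv> circuit_measure c"

abbreviation T :: "(vertex \<Rightarrow> complex) \<Rightarrow> vertex \<Rightarrow> complex" where
  "T \<equiv> composition_operator parent"

lemma vertex_weight_pos: "0 < vertex_weight c v"
  by (simp add: vertex_weight_def weight_pos split: vertex.split)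

lemma emeasure_point: "emeasure M {v} = ennreal (vertex_weight c v)"
  by (simp add: circuit_measure_def emeasure_density)

lemma measure_point: "measure M {v} = vertex_weight c v"
  using vertex_weight_pos[of v] by (simp add: measure_def emeasure_point)

sublocale discrete_measure_space M
  by unfold_locales
    (simp_all add: emeasure_point vertex_weight_pos, simp_all add: circuit_measure_def)

lemma growth_nonneg: "0 \<le> K"
proof -
  have "0 < K * c 0"
    using weight_pos[of 1] weight_growth[of 0] by simp
  then show ?thesis using weight_pos[of 0] by (simp add: zero_less_mult_iff)
qed

lemma integrable_iff_summable:
  fixes F :: "vertex \<Rightarrow> 'b :: {banach, second_countable_topology}"
  shows "integrable M F \<longleftrightarrow> summable (\<lambda>i. norm (c i *\<^sub>R F (Branch i)))"
proof -
  have "integrable M F \<longleftrightarrow> integrable (count_space UNIV) (\<lambda>v. vertex_weight c v *\<^sub>R F v)"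
    unfolding circuit_measure_def
    by (rule integrable_density) (simp_all add: vertex_weight_pos less_imp_le)
  also have "\<dots> \<longleftrightarrow> integrable (count_space UNIV)
      (\<lambda>n. vertex_weight c (vertex_of_nat n) *\<^sub>R F (vertex_of_nat n))"
    by (rule integrable_bij_count_space[OF bij_vertex_of_nat, symmetric])
  also have "\<dots> \<longleftrightarrow> summable (\<lambda>n. norm (vertex_weight c (vertex_of_nat n) *\<^sub>R F (vertex_of_nat n)))"
    by (rule integrable_count_space_nat_iff)
  also have "\<dots> \<longleftrightarrow> summable (\<lambda>i. norm (c i *\<^sub>R F (Branch i)))"
    by (subst summable_Suc_iff[symmetric]) (simp add: vertex_of_nat_def vertex_weight_def)
  finally show ?thesis .
qed

lemma integral_eq_suminf:
  fixes F :: "vertex \<Rightarrow> 'b :: {banach, second_countable_topology}"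
  assumes "integrable M F"
  shows "integral\<^sup>L M F = F Circuit + (\<Sum>i. c i *\<^sub>R F (Branch i))"
proof -
  let ?G = "\<lambda>n. vertex_weight c (vertex_of_nat n) *\<^sub>R F (vertex_of_nat n)"
  have G: "integrable (count_space UNIV) ?G"
    unfolding integrable_count_space_nat_iff using assms
    by (subst summable_Suc_iff[symmetric])
       (simp add: vertex_of_nat_def vertex_weight_def integrable_iff_summable)
  have "integral\<^sup>L M F = (\<integral>v. vertex_weight c v *\<^sub>R F v \<partial>count_space UNIV)"
    unfolding circuit_measure_def
    by (rule integral_density) (simp_all add: vertex_weight_pos less_imp_le)
  also have "\<dots> = (\<integral>n. ?G n \<partial>count_space UNIV)"
    by (rule integral_bij_count_space[OF bij_vertex_of_nat, symmetric])
  also have "\<dots> = (\<Sum>n. ?G n)"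
    by (rule integral_count_space_nat[OF G])
  also have "\<dots> = ?G 0 + (\<Sum>n. ?G (Suc n))"
    using suminf_split_head[of ?G] sums_summable[OF sums_integral_count_space_nat[OF G]] by simp
  finally show ?thesis
    by (simp add: vertex_of_nat_def vertex_weight_def)
qed

lemma L2_iff_summable: "f \<in> L2 M \<longleftrightarrow> summable (\<lambda>i. c i * (cmod (f (Branch i)))\<^sup>2)"
  using weight_pos by (simp add: L2_iff integrable_iff_summable less_imp_le)

lemma L2_inner_eq_suminf:
  assumes "f \<in> L2 M" "g \<in> L2 M"
  shows "L2_inner M f g
    = f Circuit * cnj (g Circuit) + (\<Sum>i. of_real (c i) * (f (Branch i) * cnj (g (Branch i))))"
  unfolding L2_inner_def
  by (subst integral_eq_suminf[OF integrable_L2_inner[OF assms]]) (simp add: scaleR_conv_of_real)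

lemma summable_L2_inner:
  assumes "f \<in> L2 M" "g \<in> L2 M"
  shows "summable (\<lambda>i. of_real (c i) * (f (Branch i) * cnj (g (Branch i))))"
  using integrable_L2_inner[OF assms] unfolding integrable_iff_summable
  by (auto dest!: summable_norm_cancel simp: scaleR_conv_of_real)

lemma hnorm_square:
  assumes "f \<in> L2 M"
  shows "(L2.hnorm f)\<^sup>2 = (cmod (f Circuit))\<^sup>2 + (\<Sum>i. c i * (cmod (f (Branch i)))\<^sup>2)"
proof -
  have "(L2.hnorm f)\<^sup>2 = (\<integral>x. (cmod (f x))\<^sup>2 \<partial>M)"
    by (simp add: L2.hnorm_def L2_inner_self)
  also have "\<dots> = (cmod (f Circuit))\<^sup>2 + (\<Sum>i. c i * (cmod (f (Branch i)))\<^sup>2)"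
    using assms by (subst integral_eq_suminf) (simp_all add: L2_iff)
  finally show ?thesis .
qed

lemma shifted_weight_term_le: "c (Suc i) * (cmod z)\<^sup>2 \<le> K * (c i * (cmod z)\<^sup>2)"
  using mult_right_mono[OF weight_growth, of "(cmod z)\<^sup>2" i] by (simp add: mult.assoc)

lemma summable_shifted_weight:
  assumes "f \<in> L2 M"
  shows "summable (\<lambda>i. c (Suc i) * (cmod (f (Branch i)))\<^sup>2)"
proof (rule summable_comparison_test)
  show "\<exists>N. \<forall>n\<ge>N. norm (c (Suc n) * (cmod (f (Branch n)))\<^sup>2) \<le> K * (c n * (cmod (f (Branch n)))\<^sup>2)"
    using shifted_weight_term_le weight_pos by (auto simp: abs_mult abs_of_pos)
  show "summable (\<lambda>i. K * (c i * (cmod (f (Branch i)))\<^sup>2))"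
    using assms by (auto simp: L2_iff_summable)
qed

lemma T_apply:
  "T f Circuit = f Circuit" "T f (Branch 0) = f Circuit" "T f (Branch (Suc i)) = f (Branch i)"
  by (simp_all add: composition_operator_def)

lemma T_L2:
  assumes "f \<in> L2 M"
  shows "T f \<in> L2 M"
  unfolding L2_iff_summable
  using summable_shifted_weight[OF assms]
  by (subst summable_Suc_iff[symmetric]) (simp add: T_apply)

lemma hnorm_T_le:
  assumes f: "f \<in> L2 M"
  shows "L2.hnorm (T f) \<le> sqrt (1 + c 0 + K) * L2.hnorm f"
proof -
  let ?S = "\<Sum>i. c i * (cmod (f (Branch i)))\<^sup>2"
  have sf: "summable (\<lambda>i. c i * (cmod (f (Branch i)))\<^sup>2)"
    using f by (simp add: L2_iff_summable)
  have S: "0 \<le> ?S"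
    using sf weight_pos by (intro suminf_nonneg) (simp_all add: less_imp_le)
  have "(L2.hnorm (T f))\<^sup>2 = (1 + c 0) * (cmod (f Circuit))\<^sup>2 + (\<Sum>i. c (Suc i) * (cmod (f (Branch i)))\<^sup>2)"
    using suminf_split_head[OF T_L2[OF f, unfolded L2_iff_summable]]
    by (simp add: hnorm_square[OF T_L2[OF f]] T_apply algebra_simps)
  also have "\<dots> \<le> (1 + c 0) * (cmod (f Circuit))\<^sup>2 + (\<Sum>i. K * (c i * (cmod (f (Branch i)))\<^sup>2))"
    by (intro add_left_mono suminf_le shifted_weight_term_le summable_shifted_weight f summable_mult sf)
  also have "(\<Sum>i. K * (c i * (cmod (f (Branch i)))\<^sup>2)) = K * ?S"
    using sf by (rule suminf_mult)
  also have "(1 + c 0) * (cmod (f Circuit))\<^sup>2 + K * ?S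
      \<le> (1 + c 0 + K) * ((cmod (f Circuit))\<^sup>2 + ?S)"
    using S growth_nonneg weight_pos[of 0] by (simp add: algebra_simps)
  also have "\<dots> = (sqrt (1 + c 0 + K) * L2.hnorm f)\<^sup>2"
    using growth_nonneg weight_pos[of 0] by (simp add: hnorm_square[OF f] power_mult_distrib)
  finally show ?thesis
    using growth_nonneg weight_pos[of 0]
    by (elim power2_le_imp_le) (simp add: L2.hnorm_def L2_inner_self)
qed

lemma T_bounded: "T \<in> L2.bounded_operators"
  unfolding L2.bounded_operators_def
  using T_L2 hnorm_T_le by (auto simp: composition_operator_def fun_scale_def fun_eq_iff)

text \<open>
  The adjoint of \<open>T\<close> in explicit form: sum over the fibre of the parent map with the masses as
  weights, then divide by the mass of the vertex.
\<close>

definition A :: "(vertex \<Rightarrow> complex) \<Rightarrow> vertex \<Rightarrow> complex" where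
  "A g = case_vertex (g Circuit + of_real (c 0) * g (Branch 0))
     (\<lambda>i. of_real (c (Suc i) / c i) * g (Branch (Suc i)))"

lemma A_simps:
  "A g Circuit = g Circuit + of_real (c 0) * g (Branch 0)"
  "A g (Branch i) = of_real (c (Suc i) / c i) * g (Branch (Suc i))"
  by (simp_all add: A_def)

lemma A_L2:
  assumes g: "g \<in> L2 M"
  shows "A g \<in> L2 M"
  unfolding L2_iff_summable
proof (rule summable_comparison_test)
  have "norm (c i * (cmod (A g (Branch i)))\<^sup>2) \<le> K * (c (Suc i) * (cmod (g (Branch (Suc i))))\<^sup>2)" for i
  proof -
    have "c i * (cmod (A g (Branch i)))\<^sup>2 = c (Suc i) / c i * (c (Suc i) * (cmod (g (Branch (Suc i))))\<^sup>2)"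
      using weight_pos[of i]
      by (simp add: A_simps norm_mult norm_divide power_mult_distrib power_divide power2_eq_square)
    also have "\<dots> \<le> K * (c (Suc i) * (cmod (g (Branch (Suc i))))\<^sup>2)"
      using weight_pos weight_growth[of i]
      by (intro mult_right_mono) (simp_all add: pos_divide_le_eq less_imp_le)
    finally show ?thesis
      using weight_pos[of i] by (simp add: abs_mult)
  qed
  then show "\<exists>N. \<forall>i\<ge>N. norm (c i * (cmod (A g (Branch i)))\<^sup>2)
      \<le> K * (c (Suc i) * (cmod (g (Branch (Suc i))))\<^sup>2)"
    by blast
  show "summable (\<lambda>i. K * (c (Suc i) * (cmod (g (Branch (Suc i))))\<^sup>2))"
    using g by (intro summable_mult) (simp add: L2_iff_summable summable_Suc_iff[of "\<lambda>i. c i * (cmod (g (Branch i)))\<^sup>2"])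
qed

lemma adjoint_T:
  assumes g: "g \<in> L2 M"
  shows "L2.adjoint T g = A g"
proof (rule L2.adjoint_eqI[OF A_L2[OF g]])
  fix f assume f: "f \<in> L2 M"
  have "L2_inner M (T f) g = f Circuit * cnj (g Circuit)
      + (of_real (c 0) * (f Circuit * cnj (g (Branch 0)))
         + (\<Sum>i. of_real (c (Suc i)) * (f (Branch i) * cnj (g (Branch (Suc i))))))"
    using suminf_split_head[OF summable_L2_inner[OF T_L2[OF f] g]]
    by (simp add: L2_inner_eq_suminf[OF T_L2[OF f] g] T_apply)
  also have "(\<Sum>i. of_real (c (Suc i)) * (f (Branch i) * cnj (g (Branch (Suc i)))))
      = (\<Sum>i. of_real (c i) * (f (Branch i) * cnj (A g (Branch i))))"
    using weight_pos by (intro suminf_cong) (simp add: A_simps less_imp_neq[symmetric])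
  finally show "L2_inner M (T f) g = L2_inner M f (A g)"
    by (simp add: L2_inner_eq_suminf[OF f A_L2[OF g]] A_simps algebra_simps)
qed

lemma A_funpow_L2: "g \<in> L2 M \<Longrightarrow> (A ^^ p) g \<in> L2 M"
  by (induction p) (simp_all add: A_L2)

lemma T_funpow_L2: "f \<in> L2 M \<Longrightarrow> (T ^^ p) f \<in> L2 M"
  by (induction p) (simp_all add: T_L2)

lemma adjoint_T_funpow: "g \<in> L2 M \<Longrightarrow> (L2.adjoint T ^^ p) g = (A ^^ p) g"
  by (induction p) (simp_all add: adjoint_T A_funpow_L2)

lemma A_funpow_Branch: "(A ^^ p) g (Branch i) = of_real (c (i + p) / c i) * g (Branch (i + p))"
proof (induction p arbitrary: i)
  case 0
  then show ?case using weight_pos[of i] by simp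
next
  case (Suc p)
  then show ?case using weight_pos[of "Suc i"] by (simp add: A_simps)
qed

lemma A_funpow_Circuit:
  "(A ^^ p) g Circuit = g Circuit + (\<Sum>j<p. of_real (c j) * g (Branch j))"
proof (induction p)
  case (Suc p)
  then show ?case using weight_pos[of 0] by (simp add: A_simps A_funpow_Branch)
qed simp

lemma T_funpow_Circuit: "(T ^^ p) f Circuit = f Circuit"
  by (induction p) (simp_all add: T_apply)

lemma T_funpow_Branch: "(T ^^ p) f (Branch j) = (if j < p then f Circuit else f (Branch (j - p)))"
proof (induction p arbitrary: j)
  case (Suc p)
  then show ?case
    by (cases j) (simp_all add: T_apply T_funpow_Circuit)
qed simp

lemma sum_fun_apply: "(\<Sum>j\<in>J. F j) v = (\<Sum>j\<in>J. (F j v :: complex))"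
  by (induction J rule: infinite_finite_induct) simp_all

lemma A_T_funpow:
  "(A ^^ p) ((T ^^ p) f) Circuit = of_real (1 + (\<Sum>i<p. c i)) * f Circuit"
  "(A ^^ p) ((T ^^ p) f) (Branch i) = of_real (c (i + p) / c i) * f (Branch i)"
  by (simp_all add: A_funpow_Circuit A_funpow_Branch T_funpow_Circuit T_funpow_Branch
      distrib_right sum_distrib_right)

lemma isometry_defect_apply:
  assumes f: "f \<in> L2 M"
  shows "L2.isometry_defect n T f Circuit
      = of_real (\<Sum>j=0..n. (- 1) ^ j * real (n choose j) * (1 + (\<Sum>i<n - j. c i))) * f Circuit" (is ?circuit)
    and "L2.isometry_defect n T f (Branch i)
      = of_real (\<Sum>j=0..n. (- 1) ^ j * real (n choose j) * c (i + (n - j))) / of_real (c i) * f (Branch i)" (is ?branch)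
proof -
  have defect: "L2.isometry_defect n T f v
      = (\<Sum>j=0..n. (- 1) ^ j * of_nat (n choose j) * (A ^^ (n - j)) ((T ^^ (n - j)) f) v)" for v
    by (simp add: L2.isometry_defect_def sum_fun_apply fun_scale_def
        adjoint_T_funpow[OF T_funpow_L2[OF f]])
  show ?circuit
    unfolding defect A_T_funpow of_real_sum sum_distrib_right
    by (intro sum.cong refl) (simp only: of_real_mult of_real_power of_real_minus of_real_1
        of_real_of_nat_eq mult.assoc)
  show ?branch
    unfolding defect A_T_funpow of_real_sum sum_distrib_right sum_divide_distrib
    by (intro sum.cong refl) simp
qed

lemma quasi_isometry_if_isometry_defect_0:
  assumes "\<And>f. f \<in> L2 M \<Longrightarrow> L2.isometry_defect n T f = 0"
  shows "L2.quasi_isometry k n T"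
proof -
  have A0: "A 0 = 0"
    by (rule ext) (simp add: A_def split: vertex.split)
  have "(A ^^ k) 0 = 0"
    by (induction k) (simp_all only: funpow.simps comp_apply id_apply A0)
  moreover have "0 \<in> L2 M"
    using L2.subspace_H L2.subspace_0 by blast
  ultimately show ?thesis
    unfolding L2.quasi_isometry_def
    by (simp add: T_bounded assms T_funpow_L2 adjoint_T_funpow)
qed

end

text \<open>
  The order is \<open>D + 2\<close> rather than \<open>D + 1\<close> because of the circuit vertex: the mass of its \<open>p\<close>-th preimage is
  \<open>1\<close> plus a partial sum of the weights, again a Newton expansion but of degree \<open>D + 1\<close>.
\<close>

lemma newton_weights_quasi_isometry:
  assumes pos: "\<And>n. 0 < newton_sum d D n"
    and growth: "\<And>n. newton_sum d D (Suc n) \<le> K * newton_sum d D n"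
  defines "M \<equiv> circuit_measure (newton_sum d D)"
  shows "discrete_measure_space M" and "parent \<in> M \<rightarrow>\<^sub>M M"
    and "measure M {branch_vertex n} = newton_sum d D (n - 1)"
    and "composition_operator parent \<in> L2_bounded_operators M"
    and "L2_quasi_isometry M k (D + 2) (composition_operator parent)"
proof -
  interpret weighted_circuit "newton_sum d D" K
    by unfold_locales (fact pos growth)+
  show "discrete_measure_space M"
    unfolding M_def by (fact discrete_measure_space_axioms)
  show "parent \<in> M \<rightarrow>\<^sub>M M"
    unfolding M_def by (simp add: measurable_all space_eq)
  show "measure M {branch_vertex n} = newton_sum d D (n - 1)"
    unfolding M_def by (simp add: measure_point branch_vertex_def vertex_weight_def)
  show "composition_operator parent \<in> L2_bounded_operators M"
    unfolding M_def by (rule T_bounded)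
  show "L2_quasi_isometry M k (D + 2) (composition_operator parent)"
    unfolding M_def
  proof (rule quasi_isometry_if_isometry_defect_0)
    fix f :: "vertex \<Rightarrow> complex" assume f: "f \<in> L2 (circuit_measure (newton_sum d D))"
    have "L2.isometry_defect (D + 2) T f Circuit = 0"
      unfolding isometry_defect_apply(1)[OF f] one_plus_sum_newton_sum
      by (subst alternating_newton_sum_eq_0[where i = 0, unfolded add_0_left]) simp_all
    moreover have "L2.isometry_defect (D + 2) T f (Branch i) = 0" for i
      unfolding isometry_defect_apply(2)[OF f]
      by (subst alternating_newton_sum_eq_0) simp_all
    ultimately have "L2.isometry_defect (D + 2) T f v = 0" for v
      by (cases v) (simp_all only:)
    then show "L2.isometry_defect (D + 2) T f = 0"
      by (simp add: fun_eq_iff)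
  qed
qed

section \<open>Prescribed masses on the branch\<close>

theorem theorem2p10:
  fixes m k :: nat and b :: "nat \<Rightarrow> real"
  assumes "1 \<le> m" and "1 \<le> k" and "\<forall>n\<in>{1..m}. 0 < b n"
  shows "(2 \<le> m \<longrightarrow>
            (\<exists>M :: vertex measure. discrete_measure_space M \<and> parent \<in> M \<rightarrow>\<^sub>M M \<and>
               (\<forall>n\<in>{1..m}. measure M {branch_vertex n} = b n) \<and>
               composition_operator parent \<in> L2_bounded_operators M \<and>
               L2_quasi_isometry M k (m + 2) (composition_operator parent))) \<and>
         (m = 1 \<longrightarrow>
            (\<exists>M :: vertex measure. discrete_measure_space M \<and> parent \<in> M \<rightarrow>\<^sub>M M \<and>
               measure M {branch_vertex 1} = b 1 \<and>
               composition_operator parent \<in> L2_bounded_operators M \<and>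
               L2_quasi_isometry M k 2 (composition_operator parent)))"
proof (intro conjI impI)
  assume "2 \<le> m"
  then have "0 < m" by simp
  moreover have "0 < b (Suc i)" if "i < m" for i
    using assms(3) that by simp
  ultimately obtain d K where d: "\<And>i. i < m \<Longrightarrow> newton_sum d m i = b (Suc i)"
    and pos: "\<And>n. 0 < newton_sum d m n"
    and growth: "\<And>n. newton_sum d m (Suc n) \<le> K * newton_sum d m n"
    using positive_newton_interpolation[of m "\<lambda>i. b (Suc i)"] by blast
  have "measure (circuit_measure (newton_sum d m)) {branch_vertex n} = b n" if "n \<in> {1..m}" for n
    using d[of "n - 1"] that by (auto simp: newton_weights_quasi_isometry(3)[OF pos growth])
  with newton_weights_quasi_isometry[OF pos growth]
  show "\<exists>M :: vertex measure. discrete_measure_space M \<and> parent \<in> M \<rightarrow>\<^sub>M M \<and>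
      (\<forall>n\<in>{1..m}. measure M {branch_vertex n} = b n) \<and>
      composition_operator parent \<in> L2_bounded_operators M \<and>
      L2_quasi_isometry M k (m + 2) (composition_operator parent)"
    by (intro exI[of _ "circuit_measure (newton_sum d m)"] conjI ballI)
next
  assume "m = 1"
  then have b1: "0 < b 1" using assms(3) by simp
  let ?c = "newton_sum (\<lambda>_. b 1) 0"
  have const: "?c n = b 1" for n
    by (simp add: newton_sum_def)
  have pos: "0 < ?c n" and growth: "?c (Suc n) \<le> 1 * ?c n" for n
    unfolding const using b1 by simp_all
  have "measure (circuit_measure ?c) {branch_vertex 1} = b 1"
    using newton_weights_quasi_isometry(3)[OF pos growth, of 1] unfolding const .
  moreover have "L2_quasi_isometry (circuit_measure ?c) k 2 (composition_operator parent)"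
    using newton_weights_quasi_isometry(5)[OF pos growth, of k] unfolding add_0_left .
  ultimately show "\<exists>M :: vertex measure. discrete_measure_space M \<and> parent \<in> M \<rightarrow>\<^sub>M M \<and>
      measure M {branch_vertex 1} = b 1 \<and>
      composition_operator parent \<in> L2_bounded_operators M \<and>
      L2_quasi_isometry M k 2 (composition_operator parent)"
    using newton_weights_quasi_isometry(1,2,4)[OF pos growth]
    by (intro exI[of _ "circuit_measure ?c"] conjI)
qed

end
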